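(* Let $b$ and $d$ be integers satisfying $-2d<b<2d$. For $\operatorname{Im}\tau>0$, $q=e^{\pi i\tau}$ and $u,v\in\mathbf C$, let $$A_{d,b}(u,v|\tau)=\sum_{m,n\in\mathbf Z}q^{dm^2+bmn+dn^2}e^{2iu(m+n)}e^{2iv(m-n)}$$ and $$C_{d,b}(u,v|\tau)=\sum_{m,n\in\mathbf Z}q^{dm^2+bmn+dn^2+(d+b/2)m+(d+b/2)n+d/2+b/4}e^{2iu(m+n+1)}e^{2iv(m-n)}.$$ Then for all $u,v\in\mathbf C$ and all $\tau$ with $\operatorname{Im}\tau>0$, $$A_{d,b}(u,v|4\tau)-C_{d,b}(u,v|4\tau)=\vartheta_4(u|(2d+b)\tau)\,\vartheta_4(v|(2d-b)\tau).$$ Moreover, $$A_{d,b}^2(u,v|\tau)-C_{d,b}^2(u,v|\tau)=A_{d,b}^2(u,v+\pi/2|\tau)-C_{d,b}^2(u,v+\pi/2|\tau).$$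
   Context: For $\operatorname{Im}\tau>0$, $q=e^{\pi i\tau}$ with real powers $q^r=e^{\pi i r\tau}$; when the last argument is another value $\tau'$ (such as $4\tau$), $q$ is replaced throughout the definition by $e^{\pi i\tau'}$. The theta function is $\vartheta_4(z|\tau)=\sum_{n=-\infty}^\infty(-1)^nq^{n^2}e^{2niz}$. Squares such as $A_{d,b}^2(u,v|\tau)$ denote $(A_{d,b}(u,v|\tau))^2$. *)

theory Defs
  imports "HOL-Analysis.Analysis"
begin

text \<open>The nome is \<open>q = exp (\<pi>\<i>\<tau>)\<close>. A real power \<open>q\<^sup>r\<close> is \<open>exp (\<pi>\<i>r\<tau>)\<close>, which depends on
  \<open>\<tau>\<close> and not only on \<open>q\<close>; hence \<open>\<tau>\<close> is the argument, and \<^const>\<open>powr\<close> on the complex numbers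
  (principal branch) is not used.\<close>

definition qpow :: "complex \<Rightarrow> real \<Rightarrow> complex" where
  "qpow \<tau> r = exp (of_real pi * \<i> * of_real r * \<tau>)"

text \<open>The series below are unordered (unconditional) sums over all of \<open>\<int>\<close> and \<open>\<int> \<times> \<int>\<close>. They converge
  absolutely when \<open>Im \<tau> > 0\<close> and, for the double series, \<open>-2d < b < 2d\<close>, which makes the quadratic
  form \<open>dm\<^sup>2 + bmn + dn\<^sup>2\<close> positive definite. Otherwise the values are not meaningful.\<close>

definition theta4 :: "complex \<Rightarrow> complex \<Rightarrow> complex" where
  "theta4 z \<tau> =
     (\<Sum>\<^sub>\<infinity>n::int. (-1) powi n * qpow \<tau> (of_int (n\<^sup>2)) * exp (2 * of_int n * \<i> * z))"

definition A_series :: "int \<Rightarrow> int \<Rightarrow> complex \<Rightarrow> complex \<Rightarrow> complex \<Rightarrow> complex" where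
  "A_series d b u v \<tau> =
     (\<Sum>\<^sub>\<infinity>(m::int, n::int).
        qpow \<tau> (of_int (d * m\<^sup>2 + b * m * n + d * n\<^sup>2))
        * exp (2 * \<i> * u * of_int (m + n)) * exp (2 * \<i> * v * of_int (m - n)))"

definition C_series :: "int \<Rightarrow> int \<Rightarrow> complex \<Rightarrow> complex \<Rightarrow> complex \<Rightarrow> complex" where
  "C_series d b u v \<tau> =
     (\<Sum>\<^sub>\<infinity>(m::int, n::int).
        qpow \<tau> (of_int (d * m\<^sup>2 + b * m * n + d * n\<^sup>2)
                 + (of_int d + of_int b / 2) * of_int m + (of_int d + of_int b / 2) * of_int n
                 + of_int d / 2 + of_int b / 4)
        * exp (2 * \<i> * u * of_int (m + n + 1)) * exp (2 * \<i> * v * of_int (m - n)))"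

end

theory Submission
  imports Defs
begin

text \<open>Put \<open>s = m + n\<close> and \<open>t = m - n\<close> in \<open>A\<close>, and \<open>s = m + n + 1\<close> and \<open>t = m - n\<close> in \<open>C\<close>. In both
  series the summand becomes \<open>q\<^bsup>(2d+b)s\<^sup>2/4\<^esup> q\<^bsup>(2d-b)t\<^sup>2/4\<^esup> e\<^bsup>2ius\<^esup> e\<^bsup>2ivt\<^esup>\<close>, where \<open>A\<close> runs over the
  pairs with \<open>s + t\<close> even and \<open>C\<close> over those with \<open>s + t\<close> odd. So \<open>A - C\<close> is the sum over all pairs
  with the sign \<open>(-1)\<^bsup>s+t\<^esup>\<close>, a product of two theta functions. Shifting both \<open>u\<close> and \<open>v\<close> by \<open>\<pi>/2\<close>
  negates \<open>C\<close> only, so \<open>A + C\<close> is the same product at shifted arguments, and \<open>A\<^sup>2 - C\<^sup>2\<close> is a product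
  of four theta functions which the shift of \<open>v\<close> merely permutes, since \<open>\<theta>\<^sub>4\<close> has period \<open>\<pi>\<close>.\<close>

no_notation Infinite_Set_Sum.abs_summable_on (infix \<open>abs'_summable'_on\<close> 50)

lemma abs_summable_on_Times_mult:
  fixes f :: "'a \<Rightarrow> complex" and g :: "'b \<Rightarrow> complex"
  assumes "f abs_summable_on A" and "g abs_summable_on B"
  shows "(\<lambda>(x, y). f x * g y) abs_summable_on A \<times> B"
  unfolding Infinite_Sum.abs_summable_on_Sigma_iff
  using assms
  by (auto simp: norm_mult infsum_cmult_right' abs_mult intro!: summable_on_cmult_right summable_on_cmult_left)

text \<open>Fubini: absolute summability of both factors makes the product family summable, so the
  iterated sum may be factored.\<close>

lemma infsum_Times_mult:
  fixes f :: "'a \<Rightarrow> complex" and g :: "'b \<Rightarrow> complex"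
  assumes "f abs_summable_on A" and "g abs_summable_on B"
  shows "(\<Sum>\<^sub>\<infinity>(x, y)\<in>A \<times> B. f x * g y) = infsum f A * infsum g B"
proof -
  have "(\<lambda>(x, y). f x * g y) summable_on A \<times> B"
    by (rule abs_summable_summable[OF abs_summable_on_Times_mult[OF assms]])
  from infsum_Sigma'_banach[OF this]
  have "(\<Sum>\<^sub>\<infinity>(x, y)\<in>A \<times> B. f x * g y) = (\<Sum>\<^sub>\<infinity>x\<in>A. \<Sum>\<^sub>\<infinity>y\<in>B. f x * g y)"
    by simp
  then show ?thesis
    by (simp add: infsum_cmult_right' infsum_cmult_left')
qed

text \<open>The majorant for the theta series: a geometric series on each half of the
  integers.\<close>

lemma summable_on_exp_minus_abs_int: "(\<lambda>n::int. exp (- \<bar>real_of_int n\<bar>)) summable_on UNIV"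
proof -
  have "summable (\<lambda>n. exp (-1 :: real) ^ n)"
    by (rule summable_geometric) simp
  then have nat: "(\<lambda>n::nat. exp (- real n)) summable_on UNIV"
    by (subst summable_on_UNIV_nonneg_real_iff) (auto simp flip: exp_of_nat_mult)
  have nonneg: "(\<lambda>n::int. exp (- \<bar>real_of_int n\<bar>)) summable_on range int"
    by (subst summable_on_reindex) (auto simp: inj_on_def o_def nat)
  have "(\<lambda>n::int. exp (- \<bar>real_of_int n\<bar>)) summable_on range (\<lambda>k. - int k)"
    by (subst summable_on_reindex) (auto simp: inj_on_def o_def nat)
  \<comment> \<open>Zero lies in both ranges; removing it from one makes the union disjoint.\<close>
  then have neg: "(\<lambda>n::int. exp (- \<bar>real_of_int n\<bar>)) summable_on range (\<lambda>k. - int k) - range int"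
    by (rule summable_on_subset_banach) auto
  have "range int \<union> (range (\<lambda>k. - int k) - range int) = UNIV"
    by (auto simp: image_iff) (metis int_cases2)
  with summable_on_Un_disjoint[OF nonneg neg] show ?thesis
    by simp
qed

definition theta4_term :: "complex \<Rightarrow> complex \<Rightarrow> int \<Rightarrow> complex" where
  "theta4_term z \<tau> n = (-1) powi n * qpow \<tau> (of_int (n\<^sup>2)) * exp (2 * of_int n * \<i> * z)"

lemma theta4_altdef: "theta4 z \<tau> = (\<Sum>\<^sub>\<infinity>n. theta4_term z \<tau> n)"
  by (simp add: theta4_def theta4_term_def)

lemma norm_theta4_term:
  "norm (theta4_term z \<tau> n) = exp (- (pi * Im \<tau>) * (real_of_int n)\<^sup>2 - 2 * real_of_int n * Im z)"
  by (simp add: theta4_term_def qpow_def norm_mult norm_power_int power2_eq_square flip: exp_add)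

text \<open>For \<open>Im \<tau> > 0\<close> the Gaussian factor beats the linear exponent coming
  from \<open>Im z\<close>.\<close>

lemma theta4_term_abs_summable:
  assumes "Im \<tau> > 0"
  shows "theta4_term z \<tau> abs_summable_on UNIV"
proof -
  \<comment> \<open>The \<open>+ 1\<close> in \<open>c\<close> pays for the decay
    \<open>exp (- \<bar>n\<bar>)\<close>, and completing the square in
    \<open>a * x\<^sup>2 - c * x\<close> yields the constant
    \<open>c\<^sup>2 / (4 * a)\<close>.\<close>
  define a c where "a = pi * Im \<tau>" and "c = 2 * \<bar>Im z\<bar> + 1"
  have a: "a > 0"
    using assms by (simp add: a_def)
  have "norm (theta4_term z \<tau> n) \<le> norm (exp (c\<^sup>2 / (4 * a)) * exp (- \<bar>real_of_int n\<bar>))" for n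
  proof -
    define x where "x = \<bar>real_of_int n\<bar>"
    have "0 \<le> (2 * a * x - c)\<^sup>2 / (4 * a)"
      using a by simp
    also have "\<dots> = a * x\<^sup>2 - c * x + c\<^sup>2 / (4 * a)"
      using a by (simp add: field_simps power2_eq_square)
    finally have "c * x \<le> a * x\<^sup>2 + c\<^sup>2 / (4 * a)"
      by simp
    moreover have "- (2 * real_of_int n * Im z) \<le> 2 * \<bar>Im z\<bar> * x"
      using abs_ge_minus_self[of "2 * real_of_int n * Im z"] by (simp add: x_def abs_mult mult_ac)
    ultimately have "- a * x\<^sup>2 - 2 * real_of_int n * Im z \<le> c\<^sup>2 / (4 * a) - x"
      by (simp add: c_def algebra_simps)
    then show ?thesis
      by (simp add: norm_theta4_term a_def x_def flip: exp_add)
  qed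
  moreover have "(\<lambda>n::int. exp (c\<^sup>2 / (4 * a)) * exp (- \<bar>real_of_int n\<bar>)) abs_summable_on UNIV"
    by (simp add: summable_on_cmult_right summable_on_exp_minus_abs_int)
  ultimately show ?thesis
    by (rule Infinite_Sum.abs_summable_on_comparison_test[rotated])
qed

lemma exp_int_shift_half_pi:
  "exp (2 * of_int n * \<i> * (z + of_real pi / 2)) = (-1) powi n * exp (2 * of_int n * \<i> * z)"
proof -
  have "exp (of_int n * (of_real pi * \<i>)) = (-1) powi n"
    by (simp add: exp_power_int[symmetric])
  moreover have "2 * of_int n * \<i> * (z + of_real pi / 2) = of_int n * (of_real pi * \<i>) + 2 * of_int n * \<i> * z"
    by (simp add: algebra_simps)
  ultimately show ?thesis
    by (simp only: exp_add)
qed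

text \<open>Each half shift contributes \<open>(-1) powi n\<close>, and the two signs cancel. The
  shift by \<pi> is kept as two halves, the form in which it arises when
  \<open>v + of_real pi / 2\<close> is shifted again.\<close>

lemma theta4_shift_pi: "theta4 (z + of_real pi / 2 + of_real pi / 2) \<tau> = theta4 z \<tau>"
proof -
  have "(-1) powi n * q * ((-1) powi n * ((-1) powi n * x)) = (-1) powi n * q * x" for n and q x :: complex
    by simp
  then show ?thesis
    by (simp only: theta4_def exp_int_shift_half_pi)
qed

text \<open>The shifts produce the signs of \<open>m + n\<close> and \<open>m - n\<close>, which
  have equal parity.\<close>

lemma A_series_shift_half_pi:
  "A_series d b (u + of_real pi / 2) (v + of_real pi / 2) \<tau> = A_series d b u v \<tau>"
  unfolding A_series_def
proof (intro infsum_cong, clarify)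
  fix m n :: int
  have eq: "exp (2 * \<i> * z * of_int k) = exp (2 * of_int k * \<i> * z)" for z k
    by (simp add: mult_ac)
  have sign_swap: "q * (x * y) * (x' * y') = (x * x') * (q * y * y')" for q x y x' y' :: complex
    by (simp only: mult_ac)
  have "((-1) powi (m + n) :: complex) * (-1) powi (m - n) = 1"
    by (simp add: power_int_minus_left)
  then show "qpow \<tau> (of_int (d * m\<^sup>2 + b * m * n + d * n\<^sup>2))
        * exp (2 * \<i> * (u + of_real pi / 2) * of_int (m + n)) * exp (2 * \<i> * (v + of_real pi / 2) * of_int (m - n))
      = qpow \<tau> (of_int (d * m\<^sup>2 + b * m * n + d * n\<^sup>2))
        * exp (2 * \<i> * u * of_int (m + n)) * exp (2 * \<i> * v * of_int (m - n))"
    unfolding eq exp_int_shift_half_pi sign_swap by simp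
qed

text \<open>Here \<open>m + n + 1\<close> and \<open>m - n\<close> have opposite parity, so every
  term changes sign.\<close>

lemma C_series_shift_half_pi:
  "C_series d b (u + of_real pi / 2) (v + of_real pi / 2) \<tau> = - C_series d b u v \<tau>"
  unfolding C_series_def infsum_uminus[symmetric]
proof (intro infsum_cong, clarify)
  fix m n :: int
  have eq: "exp (2 * \<i> * z * of_int k) = exp (2 * of_int k * \<i> * z)" for z k
    by (simp add: mult_ac)
  have sign_swap: "q * (x * y) * (x' * y') = (x * x') * (q * y * y')" for q x y x' y' :: complex
    by (simp only: mult_ac)
  have "((-1) powi (m + n + 1) :: complex) * (-1) powi (m - n) = -1"
    by (simp add: power_int_minus_left)
  then show "qpow \<tau> (of_int (d * m\<^sup>2 + b * m * n + d * n\<^sup>2)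
                 + (of_int d + of_int b / 2) * of_int m + (of_int d + of_int b / 2) * of_int n
                 + of_int d / 2 + of_int b / 4)
        * exp (2 * \<i> * (u + of_real pi / 2) * of_int (m + n + 1)) * exp (2 * \<i> * (v + of_real pi / 2) * of_int (m - n))
      = - (qpow \<tau> (of_int (d * m\<^sup>2 + b * m * n + d * n\<^sup>2)
                 + (of_int d + of_int b / 2) * of_int m + (of_int d + of_int b / 2) * of_int n
                 + of_int d / 2 + of_int b / 4)
        * exp (2 * \<i> * u * of_int (m + n + 1)) * exp (2 * \<i> * v * of_int (m - n)))"
    unfolding eq exp_int_shift_half_pi sign_swap by simp
qed

text \<open>The exponent \<open>r\<close> is left abstract so that the same identity serves both
  series, whose exponents are diagonalized by different substitutions.\<close>

lemma theta4_term_mult: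
  assumes "r = of_int p * (real_of_int s)\<^sup>2 / 4 + of_int p' * (real_of_int t)\<^sup>2 / 4"
  shows "theta4_term u (of_int p * \<tau> / 4) s * theta4_term v (of_int p' * \<tau> / 4) t
       = (-1) powi (s + t) * (qpow \<tau> r * exp (2 * \<i> * u * of_int s) * exp (2 * \<i> * v * of_int t))"
proof -
  have "qpow (of_int p * \<tau> / 4) (of_int (s\<^sup>2)) * qpow (of_int p' * \<tau> / 4) (of_int (t\<^sup>2)) = qpow \<tau> r"
    by (simp add: assms qpow_def algebra_simps flip: exp_add)
  then show ?thesis
    by (simp add: theta4_term_def power_int_add mult_ac)
qed

text \<open>Stated at \<open>\<tau>\<close> with quarters on the right, so that it applies both at
  \<open>4 * \<tau>\<close> for the first claim and at \<open>\<tau>\<close> itself for the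
  squares.\<close>

lemma A_series_minus_C_series:
  assumes "- 2 * d < b" and "b < 2 * d" and "Im \<tau> > 0"
  shows "A_series d b u v \<tau> - C_series d b u v \<tau>
       = theta4 u (of_int (2 * d + b) * \<tau> / 4) * theta4 v (of_int (2 * d - b) * \<tau> / 4)"
proof -
  define F where "F = (\<lambda>(s, t). theta4_term u (of_int (2 * d + b) * \<tau> / 4) s
                               * theta4_term v (of_int (2 * d - b) * \<tau> / 4) t)"
  \<comment> \<open>\<open>E\<close> is the image of \<open>(m, n)\<close> under
    \<open>(m + n, m - n)\<close>; its complement is the image under
    \<open>(m + n + 1, m - n)\<close>.\<close>
  define E where "E = {(s :: int, t). even (s + t)}"
  \<comment> \<open>The bounds on \<open>b\<close> enter here: they make both coefficients
    \<open>2 * d + b\<close> and \<open>2 * d - b\<close> positive.\<close>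
  have pos: "Im (of_int (2 * d + b) * \<tau> / 4) > 0" "Im (of_int (2 * d - b) * \<tau> / 4) > 0"
    using assms by (auto simp: Im_divide_numeral simp flip: of_int_add of_int_diff)
  note summable = pos[THEN theta4_term_abs_summable]
  have F: "F summable_on X" for X
    unfolding F_def using abs_summable_summable[OF abs_summable_on_Times_mult[OF summable]]
    by (rule summable_on_subset_banach) auto
  have even: "infsum F E = A_series d b u v \<tau>"
    unfolding A_series_def
  proof (rule infsum_reindex_bij_witness[where i = "\<lambda>(m, n). (m + n, m - n)"
        and j = "\<lambda>(s, t). ((s + t) div 2, (s - t) div 2)"])
    fix x assume "x \<in> E"
    then obtain s t where x: "x = (s, t)" and st: "even (s + t)"
      by (auto simp: E_def)
    define m n where "m = (s + t) div 2" and "n = (s - t) div 2"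
    have s: "s = m + n" and t: "t = m - n"
      unfolding m_def n_def using st by presburger+
    have r: "real_of_int (d * m\<^sup>2 + b * m * n + d * n\<^sup>2)
        = of_int (2 * d + b) * (real_of_int s)\<^sup>2 / 4 + of_int (2 * d - b) * (real_of_int t)\<^sup>2 / 4"
      by (simp add: s t field_simps power2_eq_square)
    have sign: "(-1 :: complex) powi (s + t) = 1"
      using st by simp
    show "(case case x of (s, t) \<Rightarrow> ((s + t) div 2, (s - t) div 2) of (m, n) \<Rightarrow>
          qpow \<tau> (of_int (d * m\<^sup>2 + b * m * n + d * n\<^sup>2))
          * exp (2 * \<i> * u * of_int (m + n)) * exp (2 * \<i> * v * of_int (m - n))) = F x"
      using theta4_term_mult[OF r, of u \<tau> v] sign
      by (simp only: F_def x prod.case m_def[symmetric] n_def[symmetric] s[symmetric] t[symmetric] mult_1)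
    show "(case case x of (s, t) \<Rightarrow> ((s + t) div 2, (s - t) div 2) of (m, n) \<Rightarrow> (m + n, m - n)) = x"
      by (simp only: x prod.case m_def[symmetric] n_def[symmetric] s[symmetric] t[symmetric])
  qed (auto simp: E_def)
  have odd: "infsum F (- E) = - C_series d b u v \<tau>"
    unfolding C_series_def infsum_uminus[symmetric]
  proof (rule infsum_reindex_bij_witness[where i = "\<lambda>(m, n). (m + n + 1, m - n)"
        and j = "\<lambda>(s, t). ((s + t - 1) div 2, (s - t - 1) div 2)"])
    fix x assume "x \<in> - E"
    then obtain s t where x: "x = (s, t)" and st: "odd (s + t)"
      by (auto simp: E_def)
    \<comment> \<open>Inverts \<open>s = m + n + 1\<close>, \<open>t = m - n\<close>; both divisions
      are exact because \<open>s + t\<close> is odd.\<close>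
    define m n where "m = (s + t - 1) div 2" and "n = (s - t - 1) div 2"
    have s: "s = m + n + 1" and t: "t = m - n"
      unfolding m_def n_def using st by presburger+
    \<comment> \<open>The linear and constant terms of the exponent are exactly those of
      \<open>(2 * d + b) / 4 * (m + n + 1)\<^sup>2\<close>.\<close>
    have r: "of_int (d * m\<^sup>2 + b * m * n + d * n\<^sup>2)
                 + (of_int d + of_int b / 2) * of_int m + (of_int d + of_int b / 2) * of_int n
                 + of_int d / 2 + of_int b / 4
        = of_int (2 * d + b) * (real_of_int s)\<^sup>2 / 4 + of_int (2 * d - b) * (real_of_int t)\<^sup>2 / 4"
      by (simp add: s t field_simps power2_eq_square)
    have sign: "(-1 :: complex) powi (s + t) = -1"
      using st by simp
    show "(- (case case x of (s, t) \<Rightarrow> ((s + t - 1) div 2, (s - t - 1) div 2) of (m, n) \<Rightarrow>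
          qpow \<tau> (of_int (d * m\<^sup>2 + b * m * n + d * n\<^sup>2)
                 + (of_int d + of_int b / 2) * of_int m + (of_int d + of_int b / 2) * of_int n
                 + of_int d / 2 + of_int b / 4)
          * exp (2 * \<i> * u * of_int (m + n + 1)) * exp (2 * \<i> * v * of_int (m - n)))) = F x"
      using theta4_term_mult[OF r, of u \<tau> v] sign
      by (simp only: F_def x prod.case m_def[symmetric] n_def[symmetric] s[symmetric] t[symmetric] mult_minus1)
    show "(case case x of (s, t) \<Rightarrow> ((s + t - 1) div 2, (s - t - 1) div 2) of (m, n) \<Rightarrow> (m + n + 1, m - n)) = x"
      by (simp only: x prod.case m_def[symmetric] n_def[symmetric] s[symmetric] t[symmetric])
  qed (auto simp: E_def)
  have "theta4 u (of_int (2 * d + b) * \<tau> / 4) * theta4 v (of_int (2 * d - b) * \<tau> / 4) = infsum F UNIV"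
    unfolding F_def theta4_altdef using infsum_Times_mult[OF summable] by simp
  also have "\<dots> = infsum F E + infsum F (- E)"
    using infsum_Un_disjoint[OF F F, of E "- E"] by simp
  finally show ?thesis
    by (simp add: even odd)
qed

lemma A_series_plus_C_series:
  assumes "- 2 * d < b" and "b < 2 * d" and "Im \<tau> > 0"
  shows "A_series d b u v \<tau> + C_series d b u v \<tau>
       = theta4 (u + of_real pi / 2) (of_int (2 * d + b) * \<tau> / 4)
         * theta4 (v + of_real pi / 2) (of_int (2 * d - b) * \<tau> / 4)"
  using A_series_minus_C_series[OF assms, of "u + of_real pi / 2" "v + of_real pi / 2"]
  by (simp only: A_series_shift_half_pi C_series_shift_half_pi diff_minus_eq_add)

theorem theorem5p1:
  fixes b d :: int and u v \<tau> :: complex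
  assumes "- 2 * d < b" and "b < 2 * d" and "Im \<tau> > 0"
  shows "A_series d b u v (4 * \<tau>) - C_series d b u v (4 * \<tau>)
           = theta4 u (of_int (2 * d + b) * \<tau>) * theta4 v (of_int (2 * d - b) * \<tau>)
       \<and> (A_series d b u v \<tau>)\<^sup>2 - (C_series d b u v \<tau>)\<^sup>2
           = (A_series d b u (v + of_real pi / 2) \<tau>)\<^sup>2 - (C_series d b u (v + of_real pi / 2) \<tau>)\<^sup>2"
proof
  have "Im (4 * \<tau>) > 0"
    using assms by simp
  from A_series_minus_C_series[OF assms(1,2) this, of u v]
  show "A_series d b u v (4 * \<tau>) - C_series d b u v (4 * \<tau>)
           = theta4 u (of_int (2 * d + b) * \<tau>) * theta4 v (of_int (2 * d - b) * \<tau>)"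
    by simp
  have square_diff: "x\<^sup>2 - y\<^sup>2 = (x - y) * (x + y)" for x y :: complex
    by (simp add: power2_eq_square algebra_simps)
  show "(A_series d b u v \<tau>)\<^sup>2 - (C_series d b u v \<tau>)\<^sup>2
           = (A_series d b u (v + of_real pi / 2) \<tau>)\<^sup>2 - (C_series d b u (v + of_real pi / 2) \<tau>)\<^sup>2"
    \<comment> \<open>Both sides become products of the same four theta values, at \<open>u\<close>,
      \<open>u + \<pi>/2\<close>, \<open>v\<close> and \<open>v + \<pi>/2\<close>, once
      \<open>v + \<pi>\<close> is reduced to \<open>v\<close>.\<close>
    unfolding square_diff A_series_minus_C_series[OF assms] A_series_plus_C_series[OF assms]
      theta4_shift_pi
    by (simp only: mult_ac)
qed

end
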